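(* Let $\mathbb{A}=(A,a_0,\Delta)$ be a deadlock-free nondeterministic tree automaton (i.e. $\Delta(a)\neq\emptyset$ for every $a\in A$) in which every infinite play is accepting. Let $\mathcal{T}=(U,\ell)$ be a labelled binary tree and let $\varepsilon_0\in[0,1]$. Then the following are equivalent: (1) $\mathcal{T}$ is $\varepsilon_0$-accepted by $\mathbb{A}$, i.e. $(a_0,\mathrm{root},\varepsilon_0)$ is a winning position for Verifier in the $\epsilon$-acceptance game of $\mathbb{A}$ and $\mathcal{T}$; (2) there is a labelled binary tree $\mathcal{T}'=(U',\ell')$ such that $\mathrm{bd}(\mathcal{T}',\mathcal{T})\le\varepsilon_0$ and $\mathcal{T}'$ is accepted by $\mathbb{A}$, i.e. $(a_0,\mathrm{root})$ is a winning position for Verifier in the acceptance game of $\mathbb{A}$ and $\mathcal{T}'$.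
   Context: Labels: $\Sigma=\Sigma_0\uplus\Sigma_2$ (arity-0 and arity-2 labels). A labelled binary tree $\mathcal{T}=(U,\ell)$ consists of $U\subseteq\{0,1\}^*$ that is prefix-closed and sibling-closed ($w.0\in U\iff w.1\in U$), and $\ell:U\to\Sigma$ with $\ell(w)\in\Sigma_2\iff w.0,w.1\in U$. The root is the empty word, written $\mathrm{root}$. For a set $X$ put $FX=\Sigma_0\uplus(\Sigma_2\times X\times X)$. The successor function $\gamma:U\to FU$ is $\gamma(w)=\ell(w)$ if $\ell(w)\in\Sigma_0$ and $\gamma(w)=(\ell(w),w.0,w.1)$ otherwise. Distance lifting: fix an order-preserving (monotone in each argument) function $f:[0,1]\times[0,1]\to[0,1]$. For sets $X,Y$ and $d:X\times Y\to[0,1]$ define $\bar d:FX\times FY\to[0,1]$ by $\bar d(\alpha,\beta)=0$ if $\alpha=\beta\in\Sigma_0$; $\bar d(\alpha,\beta)=f(d(x_1,y_1),d(x_2,y_2))$ if $\alpha=(\sigma,x_1,x_2)$, $\beta=(\sigma,y_1,y_2)$ with the same $\sigma\in\Sigma_2$; and $\bar d(\alpha,\beta)=1$ otherwise. Bisimulation distance: for trees $\mathcal{T}'=(U',\ell')$ (successor $\gamma'$) and $\mathcal{T}=(U,\ell)$ (successor $\gamma$), a function $d:U'\times U\to[0,1]$ is a bisimulation distance function if $d(w',w)\ge\bar d(\gamma'(w'),\gamma(w))$ for all $w',w$. Let $d^*$ be the pointwise least bisimulation distance function (it exists by Knaster–Tarski; it is the greatest post-fixpoint for the order $\ge$). Then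 $\mathrm{bd}(\mathcal{T}'_{w'},\mathcal{T}_w)=d^*(w',w)$ and $\mathrm{bd}(\mathcal{T}',\mathcal{T})=d^*(\mathrm{root},\mathrm{root})$. Automaton: $\mathbb{A}=(A,a_0,\Delta)$ with $A$ a finite set of states, $a_0\in A$, $\Delta:A\to\mathcal{P}(FA)$; all infinite plays are accepting. Relation lifting: for $R\subseteq A\times U$, $\alpha\,\bar R\,\beta$ (with $\alpha\in FA,\beta\in FU$) iff $\alpha=\beta\in\Sigma_0$, or $\alpha=(\sigma,b_1,b_2)$, $\beta=(\sigma,w_1,w_2)$ with $\sigma\in\Sigma_2$, $b_1Rw_1$ and $b_2Rw_2$. Acceptance game of $\mathbb{A}$ and a tree $(U,\ell,\gamma)$: at position $(a,w)\in A\times U$ Verifier chooses $\delta\in\Delta(a)$ and then a relation $R\subseteq A\times U$ with $\delta\,\bar R\,\gamma(w)$; then Falsifier chooses any $(b,v)\in R$, which is the next position. A player who cannot move loses; infinite plays are won by Verifier. The tree is accepted if $(a_0,\mathrm{root})$ is winning for Verifier. $\epsilon$-acceptance game of $\mathbb{A}$ and a tree $(U,\ell,\gamma)$: at position $(a,w,\varepsilon_1)\in A\times U\times[0,1]$ Verifier chooses $\delta\in\Delta(a)$ and then a function $d:A\times U\to[0,1]$ with $\bar d(\delta,\gamma(w))\le\varepsilon_1$; then Falsifier chooses any $(b,v,\varepsilon_2)\in A\times U\times[0,1]$ with $d(b,v)\le\varepsilon_2$, which is the next position. A player who cannot move loses; infinite plays are won by Verifier. The tree is $\varepsilon$-accepted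 if $(a_0,\mathrm{root},\varepsilon)$ is winning for Verifier. *)

theory Defs
  imports Complex_Main "HOL-Library.FuncSet"
begin

text \<open>The directions 0 and 1 are \<open>False\<close> and \<open>True\<close>.\<close>

type_synonym word = "bool list"

abbreviation root :: word where "root \<equiv> []"

abbreviation child0 :: "word \<Rightarrow> word" where "child0 w \<equiv> w @ [False]"
abbreviation child1 :: "word \<Rightarrow> word" where "child1 w \<equiv> w @ [True]"

record 'l ltree =
  nodes :: "word set"
  label :: "word \<Rightarrow> 'l"

definition labelled_tree :: "'l set \<Rightarrow> 'l set \<Rightarrow> 'l ltree \<Rightarrow> bool" where
  "labelled_tree Sig0 Sig2 T \<longleftrightarrow>
     root \<in> nodes T \<and>
     (\<forall>u v. u @ v \<in> nodes T \<longrightarrow> u \<in> nodes T) \<and>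
     (\<forall>w. child0 w \<in> nodes T \<longleftrightarrow> child1 w \<in> nodes T) \<and>
     (\<forall>w\<in>nodes T. label T w \<in> Sig0 \<union> Sig2) \<and>
     (\<forall>w\<in>nodes T. label T w \<in> Sig2 \<longleftrightarrow> child0 w \<in> nodes T \<and> child1 w \<in> nodes T)"

type_synonym ('l, 'x) F = "'l + 'l \<times> 'x \<times> 'x"

definition F_set :: "'l set \<Rightarrow> 'l set \<Rightarrow> 'x set \<Rightarrow> ('l, 'x) F set" where
  "F_set Sig0 Sig2 X = Sig0 <+> (Sig2 \<times> X \<times> X)"

definition succ :: "'l set \<Rightarrow> 'l ltree \<Rightarrow> word \<Rightarrow> ('l, word) F" where
  "succ Sig0 T w =
     (if label T w \<in> Sig0 then Inl (label T w) else Inr (label T w, child0 w, child1 w))"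


text \<open>Functions on a product of carriers are taken extensional,
  so that they are determined by their values on the carriers.\<close>

definition dist_funs :: "'x set \<Rightarrow> 'y set \<Rightarrow> ('x \<times> 'y \<Rightarrow> real) set" where
  "dist_funs X Y = X \<times> Y \<rightarrow>\<^sub>E {0..1}"

definition order_preserving :: "(real \<Rightarrow> real \<Rightarrow> real) \<Rightarrow> bool" where
  "order_preserving f \<longleftrightarrow>
     (\<forall>x\<in>{0..1}. \<forall>y\<in>{0..1}. f x y \<in> {0..1}) \<and>
     (\<forall>y\<in>{0..1}. mono_on {0..1} (\<lambda>x. f x y)) \<and>
     (\<forall>x\<in>{0..1}. mono_on {0..1} (\<lambda>y. f x y))"

fun dist_lift ::
    "(real \<Rightarrow> real \<Rightarrow> real) \<Rightarrow> ('x \<times> 'y \<Rightarrow> real) \<Rightarrow> ('l, 'x) F \<Rightarrow> ('l, 'y) F \<Rightarrow> real" where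
  "dist_lift f d (Inl c) (Inl c') = (if c = c' then 0 else 1)"
| "dist_lift f d (Inr (s, x1, x2)) (Inr (s', y1, y2)) =
     (if s = s' then f (d (x1, y1)) (d (x2, y2)) else 1)"
| "dist_lift f d (Inl c) (Inr q) = 1"
| "dist_lift f d (Inr p) (Inl c') = 1"

definition bisim_dist_fun ::
    "'l set \<Rightarrow> (real \<Rightarrow> real \<Rightarrow> real) \<Rightarrow> 'l ltree \<Rightarrow> 'l ltree \<Rightarrow> (word \<times> word \<Rightarrow> real) \<Rightarrow> bool" where
  "bisim_dist_fun Sig0 f T' T d \<longleftrightarrow>
     d \<in> dist_funs (nodes T') (nodes T) \<and>
     (\<forall>w'\<in>nodes T'. \<forall>w\<in>nodes T. d (w', w) \<ge> dist_lift f d (succ Sig0 T' w') (succ Sig0 T w))"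

definition least_bisim_dist_fun ::
    "'l set \<Rightarrow> (real \<Rightarrow> real \<Rightarrow> real) \<Rightarrow> 'l ltree \<Rightarrow> 'l ltree \<Rightarrow> (word \<times> word \<Rightarrow> real) \<Rightarrow> bool" where
  "least_bisim_dist_fun Sig0 f T' T d \<longleftrightarrow>
     bisim_dist_fun Sig0 f T' T d \<and>
     (\<forall>d'. bisim_dist_fun Sig0 f T' T d' \<longrightarrow>
        (\<forall>w'\<in>nodes T'. \<forall>w\<in>nodes T. d (w', w) \<le> d' (w', w)))"

definition d_star ::
    "'l set \<Rightarrow> (real \<Rightarrow> real \<Rightarrow> real) \<Rightarrow> 'l ltree \<Rightarrow> 'l ltree \<Rightarrow> word \<times> word \<Rightarrow> real" where
  "d_star Sig0 f T' T = (THE d. least_bisim_dist_fun Sig0 f T' T d)"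

definition bd :: "'l set \<Rightarrow> (real \<Rightarrow> real \<Rightarrow> real) \<Rightarrow> 'l ltree \<Rightarrow> 'l ltree \<Rightarrow> real" where
  "bd Sig0 f T' T = d_star Sig0 f T' T (root, root)"

lemma succ_in_F_set:
  assumes "labelled_tree Sig0 Sig2 T" "w \<in> nodes T"
  shows "succ Sig0 T w \<in> F_set Sig0 Sig2 (nodes T)"
  using assms unfolding labelled_tree_def succ_def F_set_def by auto

lemma dist_lift_mono:
  assumes f: "order_preserving f"
    and d: "d \<in> dist_funs X Y" "d' \<in> dist_funs X Y"
    and le: "\<And>x y. x \<in> X \<Longrightarrow> y \<in> Y \<Longrightarrow> d (x, y) \<le> d' (x, y)"
    and ab: "a \<in> F_set Sig0 Sig2 X" "b \<in> F_set Sig0 Sig2 Y"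
  shows "dist_lift f d a b \<le> dist_lift f d' a b"
proof -
  have *: "f (d (x1, y1)) (d (x2, y2)) \<le> f (d' (x1, y1)) (d' (x2, y2))"
    if "x1 \<in> X" "x2 \<in> X" "y1 \<in> Y" "y2 \<in> Y" for x1 x2 y1 y2
  proof -
    have in01: "d (x1, y1) \<in> {0..1}" "d' (x1, y1) \<in> {0..1}"
      "d (x2, y2) \<in> {0..1}" "d' (x2, y2) \<in> {0..1}"
      using d that unfolding dist_funs_def by (blast intro: PiE_mem)+
    have "f (d (x1, y1)) (d (x2, y2)) \<le> f (d' (x1, y1)) (d (x2, y2))"
      using f in01 le[of x1 y1] that unfolding order_preserving_def
      by (auto dest!: bspec[of _ _ "d (x2, y2)"] intro: mono_onD)
    also have "\<dots> \<le> f (d' (x1, y1)) (d' (x2, y2))"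
      using f in01 le[of x2 y2] that unfolding order_preserving_def
      by (metis mono_onD)
    finally show ?thesis .
  qed
  show ?thesis
    using ab * unfolding F_set_def by auto
qed

lemma dist_lift_in_01:
  assumes f: "order_preserving f" and d: "d \<in> dist_funs X Y"
    and ab: "a \<in> F_set Sig0 Sig2 X" "b \<in> F_set Sig0 Sig2 Y"
  shows "dist_lift f d a b \<in> {0..1}"
proof -
  have in01: "d (x, y) \<in> {0..1}" if "x \<in> X" "y \<in> Y" for x y
    using d that unfolding dist_funs_def by (blast intro: PiE_mem)
  have "f (d (x1, y1)) (d (x2, y2)) \<in> {0..1}"
    if "x1 \<in> X" "x2 \<in> X" "y1 \<in> Y" "y2 \<in> Y" for x1 x2 y1 y2
    using f in01 that unfolding order_preserving_def by blast
  then show ?thesis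
    using ab unfolding F_set_def by auto
qed

lemma ex1_least_bisim_dist_fun:
  assumes f: "order_preserving f"
    and T': "labelled_tree Sig0 Sig2 T'" and T: "labelled_tree Sig0 Sig2 T"
  shows "\<exists>!d. least_bisim_dist_fun Sig0 f T' T d"
proof -
  let ?X = "nodes T'" and ?Y = "nodes T"
  let ?B = "{d. bisim_dist_fun Sig0 f T' T d}"
  define m where "m = (\<lambda>p\<in>?X \<times> ?Y. INF d\<in>?B. d p)"
  define one where "one = (\<lambda>p\<in>?X \<times> ?Y. 1::real)"
  have one_fun: "one \<in> dist_funs ?X ?Y"
    unfolding one_def dist_funs_def by auto
  have one: "one \<in> ?B"
    using one_fun dist_lift_in_01[OF f one_fun succ_in_F_set[OF T'] succ_in_F_set[OF T]]
    unfolding bisim_dist_fun_def by (auto simp: one_def)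
  have B01: "d (x, y) \<in> {0..1}" if "d \<in> ?B" "x \<in> ?X" "y \<in> ?Y" for d x y
    using that unfolding bisim_dist_fun_def dist_funs_def by (blast intro: PiE_mem)
  have bdd: "bdd_below ((\<lambda>d. d (x, y)) ` ?B)" if "x \<in> ?X" "y \<in> ?Y" for x y
    by (rule bdd_belowI2[where m = 0]) (use B01 that in auto)
  have m_le: "m (x, y) \<le> d (x, y)" if "d \<in> ?B" "x \<in> ?X" "y \<in> ?Y" for d x y
    using that bdd[of x y] unfolding m_def by (auto intro: cINF_lower)
  have m_ge: "m (x, y) \<ge> c"
    if "\<And>d. d \<in> ?B \<Longrightarrow> c \<le> d (x, y)" "x \<in> ?X" "y \<in> ?Y" for c x y
    using that one unfolding m_def by (auto intro!: cINF_greatest)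
  have m_fun: "m \<in> dist_funs ?X ?Y"
  proof -
    have "m (x, y) \<in> {0..1}" if "x \<in> ?X" "y \<in> ?Y" for x y
    proof -
      have "m (x, y) \<ge> 0" using m_ge[of 0 x y] B01 that by auto
      moreover have "m (x, y) \<le> 1" using m_le[OF one that] that by (simp add: one_def)
      ultimately show ?thesis by simp
    qed
    moreover have "m p = undefined" if "p \<notin> ?X \<times> ?Y" for p
      using that unfolding m_def restrict_def by (simp only: if_False)
    ultimately show ?thesis
      unfolding dist_funs_def by (intro PiE_I) blast+
  qed
  have "bisim_dist_fun Sig0 f T' T m"
    unfolding bisim_dist_fun_def
  proof (intro conjI ballI m_fun m_ge)
    fix x y d assume xy: "x \<in> ?X" "y \<in> ?Y" and d: "d \<in> ?B"
    have "dist_lift f m (succ Sig0 T' x) (succ Sig0 T y)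
        \<le> dist_lift f d (succ Sig0 T' x) (succ Sig0 T y)"
      using d m_le xy succ_in_F_set[OF T'] succ_in_F_set[OF T]
      by (intro dist_lift_mono[OF f m_fun]) (auto simp: bisim_dist_fun_def)
    also have "\<dots> \<le> d (x, y)"
      using d xy by (simp add: bisim_dist_fun_def)
    finally show "dist_lift f m (succ Sig0 T' x) (succ Sig0 T y) \<le> d (x, y)" .
  qed
  then have least: "least_bisim_dist_fun Sig0 f T' T m"
    using m_le unfolding least_bisim_dist_fun_def by blast
  show ?thesis
  proof (rule ex1I[where a = m], rule least)
    fix d assume d: "least_bisim_dist_fun Sig0 f T' T d"
    show "d = m"
    proof (rule PiE_ext)
      show "d \<in> ?X \<times> ?Y \<rightarrow>\<^sub>E {0..1}" "m \<in> ?X \<times> ?Y \<rightarrow>\<^sub>E {0..1}"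
        using d m_fun
        unfolding least_bisim_dist_fun_def bisim_dist_fun_def dist_funs_def by auto
      show "d p = m p" if pin: "p \<in> ?X \<times> ?Y" for p
      proof -
        obtain x y where p: "p = (x, y)" "x \<in> ?X" "y \<in> ?Y" using pin by blast
        have "d (x, y) \<le> m (x, y)" "m (x, y) \<le> d (x, y)"
          using p d least unfolding least_bisim_dist_fun_def by blast+
        then show ?thesis using p by simp
      qed
    qed
  qed
qed


text \<open>\<open>inf_wins\<close> is the set of infinite plays won by Verifier. A strategy
  maps the history of a play to the next position.\<close>

datatype player = Verifier | Falsifier

record 'p game =
  owner :: "'p \<Rightarrow> player"
  moves :: "'p \<Rightarrow> 'p set"
  inf_wins :: "(nat \<Rightarrow> 'p) set"

definition partial_play :: "'p game \<Rightarrow> 'p \<Rightarrow> 'p list \<Rightarrow> bool" where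
  "partial_play G p ps \<longleftrightarrow>
     ps \<noteq> [] \<and> hd ps = p \<and> (\<forall>i. Suc i < length ps \<longrightarrow> ps ! Suc i \<in> moves G (ps ! i))"

definition finite_play :: "'p game \<Rightarrow> 'p \<Rightarrow> 'p list \<Rightarrow> bool" where
  "finite_play G p ps \<longleftrightarrow> partial_play G p ps \<and> moves G (last ps) = {}"

definition infinite_play :: "'p game \<Rightarrow> 'p \<Rightarrow> (nat \<Rightarrow> 'p) \<Rightarrow> bool" where
  "infinite_play G p \<pi> \<longleftrightarrow> \<pi> 0 = p \<and> (\<forall>i. \<pi> (Suc i) \<in> moves G (\<pi> i))"

definition verifier_strategy :: "'p game \<Rightarrow> 'p \<Rightarrow> ('p list \<Rightarrow> 'p) \<Rightarrow> bool" where
  "verifier_strategy G p \<sigma> \<longleftrightarrow>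
     (\<forall>ps. partial_play G p ps \<and> owner G (last ps) = Verifier \<and> moves G (last ps) \<noteq> {} \<longrightarrow>
        \<sigma> ps \<in> moves G (last ps))"

definition conforms_finite :: "'p game \<Rightarrow> ('p list \<Rightarrow> 'p) \<Rightarrow> 'p list \<Rightarrow> bool" where
  "conforms_finite G \<sigma> ps \<longleftrightarrow>
     (\<forall>i. Suc i < length ps \<and> owner G (ps ! i) = Verifier \<longrightarrow>
        ps ! Suc i = \<sigma> (take (Suc i) ps))"

definition conforms_infinite :: "'p game \<Rightarrow> ('p list \<Rightarrow> 'p) \<Rightarrow> (nat \<Rightarrow> 'p) \<Rightarrow> bool" where
  "conforms_infinite G \<sigma> \<pi> \<longleftrightarrow>
     (\<forall>i. owner G (\<pi> i) = Verifier \<longrightarrow> \<pi> (Suc i) = \<sigma> (map \<pi> [0..<Suc i]))"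

definition winning_for_verifier :: "'p game \<Rightarrow> 'p \<Rightarrow> bool" where
  "winning_for_verifier G p \<longleftrightarrow>
     (\<exists>\<sigma>. verifier_strategy G p \<sigma> \<and>
        (\<forall>ps. finite_play G p ps \<and> conforms_finite G \<sigma> ps \<longrightarrow> owner G (last ps) = Falsifier) \<and>
        (\<forall>\<pi>. infinite_play G p \<pi> \<and> conforms_infinite G \<sigma> \<pi> \<longrightarrow> \<pi> \<in> inf_wins G))"


text \<open>In both acceptance games Verifier's two consecutive choices in a round are
  two moves, with an intermediate position that records the chosen \<open>\<delta>\<close>.\<close>

record ('q, 'l) automaton =
  states :: "'q set"
  init :: 'q
  trans :: "'q \<Rightarrow> ('l, 'q) F set"

definition tree_automaton :: "'l set \<Rightarrow> 'l set \<Rightarrow> ('q, 'l) automaton \<Rightarrow> bool" where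
  "tree_automaton Sig0 Sig2 \<A> \<longleftrightarrow>
     finite (states \<A>) \<and> init \<A> \<in> states \<A> \<and>
     (\<forall>a\<in>states \<A>. trans \<A> a \<subseteq> F_set Sig0 Sig2 (states \<A>))"

definition deadlock_free :: "('q, 'l) automaton \<Rightarrow> bool" where
  "deadlock_free \<A> \<longleftrightarrow> (\<forall>a\<in>states \<A>. trans \<A> a \<noteq> {})"

fun rel_lift :: "('x \<times> 'y) set \<Rightarrow> ('l, 'x) F \<Rightarrow> ('l, 'y) F \<Rightarrow> bool" where
  "rel_lift R (Inl c) (Inl c') \<longleftrightarrow> c = c'"
| "rel_lift R (Inr (s, x1, x2)) (Inr (s', y1, y2)) \<longleftrightarrow> s = s' \<and> (x1, y1) \<in> R \<and> (x2, y2) \<in> R"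
| "rel_lift R (Inl c) (Inr q) \<longleftrightarrow> False"
| "rel_lift R (Inr p) (Inl c') \<longleftrightarrow> False"

datatype ('q, 'l) acc_pos =
    AState 'q word
  | AChosen "('l, 'q) F" word
  | ARel "('q \<times> word) set"

fun acc_owner :: "('q, 'l) acc_pos \<Rightarrow> player" where
  "acc_owner (AState a w) = Verifier"
| "acc_owner (AChosen \<delta> w) = Verifier"
| "acc_owner (ARel R) = Falsifier"

fun acc_moves ::
    "'l set \<Rightarrow> ('q, 'l) automaton \<Rightarrow> 'l ltree \<Rightarrow> ('q, 'l) acc_pos \<Rightarrow> ('q, 'l) acc_pos set" where
  "acc_moves Sig0 \<A> T (AState a w) = {AChosen \<delta> w | \<delta>. \<delta> \<in> trans \<A> a}"
| "acc_moves Sig0 \<A> T (AChosen \<delta> w) =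
     {ARel R | R. R \<subseteq> states \<A> \<times> nodes T \<and> rel_lift R \<delta> (succ Sig0 T w)}"
| "acc_moves Sig0 \<A> T (ARel R) = {AState b v | b v. (b, v) \<in> R}"

definition acceptance_game ::
    "'l set \<Rightarrow> ('q, 'l) automaton \<Rightarrow> 'l ltree \<Rightarrow> ('q, 'l) acc_pos game" where
  "acceptance_game Sig0 \<A> T =
     \<lparr>owner = acc_owner, moves = acc_moves Sig0 \<A> T, inf_wins = UNIV\<rparr>"

definition accepted :: "'l set \<Rightarrow> ('q, 'l) automaton \<Rightarrow> 'l ltree \<Rightarrow> bool" where
  "accepted Sig0 \<A> T \<longleftrightarrow>
     winning_for_verifier (acceptance_game Sig0 \<A> T) (AState (init \<A>) root)"

datatype ('q, 'l) eps_pos =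
    EState 'q word real
  | EChosen "('l, 'q) F" word real
  | EDist "'q \<times> word \<Rightarrow> real"

fun eps_owner :: "('q, 'l) eps_pos \<Rightarrow> player" where
  "eps_owner (EState a w e) = Verifier"
| "eps_owner (EChosen \<delta> w e) = Verifier"
| "eps_owner (EDist d) = Falsifier"

fun eps_moves ::
    "'l set \<Rightarrow> (real \<Rightarrow> real \<Rightarrow> real) \<Rightarrow> ('q, 'l) automaton \<Rightarrow> 'l ltree \<Rightarrow>
     ('q, 'l) eps_pos \<Rightarrow> ('q, 'l) eps_pos set" where
  "eps_moves Sig0 f \<A> T (EState a w e) = {EChosen \<delta> w e | \<delta>. \<delta> \<in> trans \<A> a}"
| "eps_moves Sig0 f \<A> T (EChosen \<delta> w e) =
     {EDist d | d. d \<in> dist_funs (states \<A>) (nodes T) \<and> dist_lift f d \<delta> (succ Sig0 T w) \<le> e}"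
| "eps_moves Sig0 f \<A> T (EDist d) =
     {EState b v e | b v e. b \<in> states \<A> \<and> v \<in> nodes T \<and> e \<in> {0..1} \<and> d (b, v) \<le> e}"

definition eps_acceptance_game ::
    "'l set \<Rightarrow> (real \<Rightarrow> real \<Rightarrow> real) \<Rightarrow> ('q, 'l) automaton \<Rightarrow> 'l ltree \<Rightarrow> ('q, 'l) eps_pos game" where
  "eps_acceptance_game Sig0 f \<A> T =
     \<lparr>owner = eps_owner, moves = eps_moves Sig0 f \<A> T, inf_wins = UNIV\<rparr>"

definition eps_accepted ::
    "'l set \<Rightarrow> (real \<Rightarrow> real \<Rightarrow> real) \<Rightarrow> real \<Rightarrow> ('q, 'l) automaton \<Rightarrow> 'l ltree \<Rightarrow> bool" where
  "eps_accepted Sig0 f e \<A> T \<longleftrightarrow>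
     winning_for_verifier (eps_acceptance_game Sig0 f \<A> T) (EState (init \<A>) root e)"

end

theory Submission imports Defs begin

text \<open>Since Verifier wins every infinite play, both games are safety games, and a position is
  winning iff it lies in a set of positions that Verifier can avoid leaving.
  Given such a set for the \<open>\<epsilon>\<close>-game, unravelling Verifier's choices of transitions yields \<open>T'\<close>;
  the distance that equals the current budget on the diagonal and 1 elsewhere is a bisimulation
  distance function. A budget of 1 imposes no constraint, so once it is reached any transition may
  be followed; this is where deadlock-freeness enters. Conversely, Verifier plays the \<open>\<epsilon>\<close>-game by simulating
  a play on \<open>T'\<close>, offering distances to \<open>T'\<close> on the two chosen successors and 1 elsewhere; restricting
  to these successors avoids infima that are not attained.\<close>

section \<open>Safety regions of games and winning strategies\<close>

text \<open>A safety region without Verifier dead ends: the nonempty intersection provides a move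
  and keeps it inside, while a Falsifier dead end meets its condition vacuously.\<close>

definition verifier_closed :: "'p game \<Rightarrow> 'p set \<Rightarrow> bool" where
  "verifier_closed G W \<longleftrightarrow>
     (\<forall>q\<in>W. (owner G q = Verifier \<longrightarrow> moves G q \<inter> W \<noteq> {}) \<and>
            (owner G q = Falsifier \<longrightarrow> moves G q \<subseteq> W))"

lemma verifier_closed_Verifier:
  assumes "verifier_closed G W" "q \<in> W" "owner G q = Verifier"
  shows "moves G q \<inter> W \<noteq> {}"
  using assms unfolding verifier_closed_def by blast

lemma verifier_closed_Falsifier:
  assumes "verifier_closed G W" "q \<in> W" "owner G q = Falsifier"
  shows "moves G q \<subseteq> W"
  using assms unfolding verifier_closed_def by blast

lemma partial_play_snoc:
  assumes "partial_play G p ps" "q \<in> moves G (last ps)"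
  shows "partial_play G p (ps @ [q])"
proof -
  have "(ps @ [q]) ! Suc i \<in> moves G ((ps @ [q]) ! i)" if "Suc i < length (ps @ [q])" for i
  proof (cases "Suc i < length ps")
    case True
    then show ?thesis using assms(1) by (simp add: nth_append partial_play_def)
  next
    case False
    then have len: "length ps = Suc i" using that by simp
    then have "last ps = ps ! i" by (metis diff_Suc_1 last_conv_nth length_0_conv nat.distinct(1))
    then show ?thesis using assms(2) len by (simp add: nth_append)
  qed
  then show ?thesis using assms(1) by (simp add: partial_play_def)
qed

lemma conforms_finite_snoc:
  assumes "conforms_finite G \<sigma> ps" "ps \<noteq> []" "owner G (last ps) = Verifier \<longrightarrow> q = \<sigma> ps"
  shows "conforms_finite G \<sigma> (ps @ [q])"
  unfolding conforms_finite_def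
proof (intro allI impI)
  fix i assume i: "Suc i < length (ps @ [q]) \<and> owner G ((ps @ [q]) ! i) = Verifier"
  show "(ps @ [q]) ! Suc i = \<sigma> (take (Suc i) (ps @ [q]))"
  proof (cases "Suc i < length ps")
    case True
    then show ?thesis using i assms(1) by (auto simp: nth_append conforms_finite_def)
  next
    case False
    then have "Suc i = length ps" using i by auto
    then have "last ps = ps ! i" "i < length ps"
      using assms(2) by (simp_all add: last_conv_nth flip: \<open>Suc i = length ps\<close>)
    then show ?thesis using i assms(3) \<open>Suc i = length ps\<close> by (simp add: nth_append)
  qed
qed

text \<open>Strategies may depend on the history, so the region consists of the last positions of
  all conforming partial plays. Extending such a play by the strategy's move, or by any move of
  Falsifier, gives another one; a Verifier dead end would complete a conforming finite play that
  Verifier loses.\<close>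

lemma winning_imp_verifier_closed:
  assumes "winning_for_verifier G p"
  shows "\<exists>W. p \<in> W \<and> verifier_closed G W"
proof -
  obtain \<sigma> where \<sigma>: "verifier_strategy G p \<sigma>"
    and fin: "\<And>ps. finite_play G p ps \<Longrightarrow> conforms_finite G \<sigma> ps \<Longrightarrow> owner G (last ps) = Falsifier"
    using assms unfolding winning_for_verifier_def by blast
  define W where "W = {last ps | ps. partial_play G p ps \<and> conforms_finite G \<sigma> ps}"
  have "partial_play G p [p]" "conforms_finite G \<sigma> [p]"
    by (auto simp: partial_play_def conforms_finite_def)
  then have "p \<in> W" unfolding W_def by force
  moreover have "verifier_closed G W"
    unfolding verifier_closed_def
  proof (intro ballI conjI impI)
    fix q assume "q \<in> W" and V: "owner G q = Verifier"
    then obtain ps where ps: "partial_play G p ps" "conforms_finite G \<sigma> ps" "q = last ps"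
      unfolding W_def by blast
    have "moves G q \<noteq> {}"
      using fin[OF _ ps(2)] ps V unfolding finite_play_def by auto
    then have m: "\<sigma> ps \<in> moves G q"
      using \<sigma> ps V unfolding verifier_strategy_def by blast
    have "partial_play G p (ps @ [\<sigma> ps])" "conforms_finite G \<sigma> (ps @ [\<sigma> ps])"
      using partial_play_snoc[of G p ps "\<sigma> ps"] conforms_finite_snoc[of G \<sigma> ps "\<sigma> ps"] ps m
      by (auto simp: partial_play_def)
    then have "\<sigma> ps \<in> W" unfolding W_def by force
    then show "moves G q \<inter> W \<noteq> {}" using m by blast
  next
    fix q assume "q \<in> W" and V: "owner G q = Falsifier"
    then obtain ps where ps: "partial_play G p ps" "conforms_finite G \<sigma> ps" "q = last ps"
      unfolding W_def by blast
    show "moves G q \<subseteq> W"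
    proof
      fix r assume r: "r \<in> moves G q"
      have "partial_play G p (ps @ [r])" "conforms_finite G \<sigma> (ps @ [r])"
        using partial_play_snoc[of G p ps r] conforms_finite_snoc[of G \<sigma> ps r] ps r V
        by (auto simp: partial_play_def)
      then show "r \<in> W" unfolding W_def by force
    qed
  qed
  ultimately show ?thesis by blast
qed

text \<open>A memoryless strategy that stays in \<open>W\<close> suffices. By induction conforming
  finite plays never leave \<open>W\<close>, so they cannot end at a Verifier position; infinite
  plays are won by \<open>inf\<close>.\<close>

lemma verifier_closed_imp_winning:
  assumes "p \<in> W" and W: "verifier_closed G W" and inf: "inf_wins G = UNIV"
  shows "winning_for_verifier G p"
proof -
  \<comment> \<open>\<open>verifier_strategy\<close> asks for a legal move after every partial play,
    conforming or not; the second branch supplies one when the play stands outside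
    \<open>W\<close>.\<close>
  define \<sigma> where "\<sigma> ps = (if last ps \<in> W then SOME q. q \<in> moves G (last ps) \<inter> W
    else SOME q. q \<in> moves G (last ps))" for ps
  have in_W: "\<sigma> ps \<in> moves G (last ps) \<inter> W" if "last ps \<in> W" "owner G (last ps) = Verifier" for ps
  proof -
    have "\<exists>q. q \<in> moves G (last ps) \<inter> W"
      using W that unfolding verifier_closed_def by blast
    then show ?thesis using that(1) unfolding \<sigma>_def by (simp only: if_True) (rule someI_ex)
  qed
  have "verifier_strategy G p \<sigma>"
    unfolding verifier_strategy_def
  proof (intro allI impI)
    fix ps
    assume ps: "partial_play G p ps \<and> owner G (last ps) = Verifier \<and> moves G (last ps) \<noteq> {}"
    show "\<sigma> ps \<in> moves G (last ps)"
    proof (cases "last ps \<in> W")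
      case True
      then show ?thesis using in_W ps by blast
    next
      case False
      then show ?thesis using ps unfolding \<sigma>_def by (simp add: some_in_eq)
    qed
  qed
  moreover have "owner G (last ps) = Falsifier" if "finite_play G p ps" "conforms_finite G \<sigma> ps" for ps
  proof -
    have ps: "ps \<noteq> []" "ps ! 0 = p"
      and mv: "\<And>i. Suc i < length ps \<Longrightarrow> ps ! Suc i \<in> moves G (ps ! i)"
      and empty: "moves G (last ps) = {}"
      using that(1) by (auto simp: finite_play_def partial_play_def hd_conv_nth)
    have "ps ! i \<in> W" if "i < length ps" for i
      using that
    proof (induction i)
      case 0
      then show ?case using ps assms(1) by simp
    next
      case (Suc i)
      then have IH: "ps ! i \<in> W" by simp
      have last: "last (take (Suc i) ps) = ps ! i"
        using Suc.prems by (simp add: take_Suc_conv_app_nth)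
      show ?case
      proof (cases "owner G (ps ! i)")
        case Verifier
        then have "ps ! Suc i = \<sigma> (take (Suc i) ps)"
          using \<open>conforms_finite G \<sigma> ps\<close> Suc.prems unfolding conforms_finite_def by blast
        then show ?thesis using in_W[of "take (Suc i) ps"] last IH Verifier by simp
      next
        case Falsifier
        then show ?thesis using W IH mv[OF Suc.prems] unfolding verifier_closed_def by blast
      qed
    qed
    then have "last ps \<in> W" using ps by (simp add: last_conv_nth)
    then show ?thesis
      using W empty unfolding verifier_closed_def by (cases "owner G (last ps)") auto
  qed
  ultimately show ?thesis
    unfolding winning_for_verifier_def using inf by blast
qed


section \<open>Safety regions of the two acceptance games, reduced to state positions\<close>

text \<open>A whole round is collapsed into one condition. Since \<open>rel_lift\<close> is monotone
  in the relation, Verifier may offer all of \<open>V\<close> at every position instead of a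
  relation tailored to it.\<close>

definition acc_closed :: "'l set \<Rightarrow> ('q, 'l) automaton \<Rightarrow> 'l ltree \<Rightarrow> ('q \<times> word) set \<Rightarrow> bool" where
  "acc_closed Sig0 \<A> T V \<longleftrightarrow>
     V \<subseteq> states \<A> \<times> nodes T \<and>
     (\<forall>(a, w)\<in>V. \<exists>\<delta>\<in>trans \<A> a. rel_lift V \<delta> (succ Sig0 T w))"

lemma rel_lift_mono:
  assumes "rel_lift R \<alpha> \<beta>" "R \<subseteq> S"
  shows "rel_lift S \<alpha> \<beta>"
  using assms by (induction R \<alpha> \<beta> rule: rel_lift.induct) auto

lemma accepted_iff:
  assumes "init \<A> \<in> states \<A>" "root \<in> nodes T"
  shows "accepted Sig0 \<A> T \<longleftrightarrow> (\<exists>V. (init \<A>, root) \<in> V \<and> acc_closed Sig0 \<A> T V)"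
proof
  let ?G = "acceptance_game Sig0 \<A> T"
  assume "accepted Sig0 \<A> T"
  then obtain W where W: "AState (init \<A>) root \<in> W" "verifier_closed ?G W"
    unfolding accepted_def by (blast dest: winning_imp_verifier_closed)
  define V where "V = {(a, w). a \<in> states \<A> \<and> w \<in> nodes T \<and> AState a w \<in> W}"
  have "\<exists>\<delta>\<in>trans \<A> a. rel_lift V \<delta> (succ Sig0 T w)" if "(a, w) \<in> V" for a w
  proof -
    have "AState a w \<in> W" using that by (simp add: V_def)
    then have "acc_moves Sig0 \<A> T (AState a w) \<inter> W \<noteq> {}"
      using verifier_closed_Verifier[OF W(2), of "AState a w"] by (simp add: acceptance_game_def)
    then obtain \<delta> where \<delta>: "\<delta> \<in> trans \<A> a" "AChosen \<delta> w \<in> W" by auto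
    then have "acc_moves Sig0 \<A> T (AChosen \<delta> w) \<inter> W \<noteq> {}"
      using verifier_closed_Verifier[OF W(2), of "AChosen \<delta> w"] by (simp add: acceptance_game_def)
    then obtain R where R: "R \<subseteq> states \<A> \<times> nodes T" "rel_lift R \<delta> (succ Sig0 T w)" "ARel R \<in> W"
      by auto
    then have "acc_moves Sig0 \<A> T (ARel R) \<subseteq> W"
      using verifier_closed_Falsifier[OF W(2), of "ARel R"] by (simp add: acceptance_game_def)
    \<comment> \<open>Falsifier may pick any pair of \<open>R\<close>, so closedness of
      \<open>W\<close> puts every such pair into \<open>V\<close>.\<close>
    then have "R \<subseteq> V" using R(1) unfolding V_def by auto
    then show ?thesis using \<delta> R rel_lift_mono by blast
  qed
  then have "acc_closed Sig0 \<A> T V" unfolding acc_closed_def by (auto simp: V_def)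
  moreover have "(init \<A>, root) \<in> V" using W assms by (simp add: V_def)
  ultimately show "\<exists>V. (init \<A>, root) \<in> V \<and> acc_closed Sig0 \<A> T V" by blast
next
  let ?G = "acceptance_game Sig0 \<A> T"
  assume "\<exists>V. (init \<A>, root) \<in> V \<and> acc_closed Sig0 \<A> T V"
  then obtain V where V: "(init \<A>, root) \<in> V" "acc_closed Sig0 \<A> T V" by blast
  \<comment> \<open>The intermediate positions are rebuilt from \<open>V\<close>: every chosen
    transition that \<open>V\<close> can answer, and \<open>V\<close> as the only relation ever
    offered.\<close>
  define W where "W = {AState a w | a w. (a, w) \<in> V}
    \<union> {AChosen \<delta> w | \<delta> w. rel_lift V \<delta> (succ Sig0 T w)} \<union> {ARel V}"
  have "verifier_closed ?G W"
    unfolding verifier_closed_def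
  proof
    fix q assume "q \<in> W"
    then consider (S) a w where "q = AState a w" "(a, w) \<in> V"
      | (C) \<delta> w where "q = AChosen \<delta> w" "rel_lift V \<delta> (succ Sig0 T w)"
      | (R) "q = ARel V"
      unfolding W_def by blast
    then show "(owner ?G q = Verifier \<longrightarrow> moves ?G q \<inter> W \<noteq> {}) \<and>
       (owner ?G q = Falsifier \<longrightarrow> moves ?G q \<subseteq> W)"
    proof cases
      case S
      with V(2) obtain \<delta> where "\<delta> \<in> trans \<A> a" "rel_lift V \<delta> (succ Sig0 T w)"
        unfolding acc_closed_def by blast
      then have "AChosen \<delta> w \<in> moves ?G q \<inter> W"
        using S by (simp add: W_def acceptance_game_def)
      then show ?thesis using S by (auto simp: acceptance_game_def)
    next
      case C
      then have "ARel V \<in> moves ?G q \<inter> W"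
        using V(2) by (simp add: W_def acceptance_game_def acc_closed_def)
      then show ?thesis using C by (auto simp: acceptance_game_def)
    next
      case R
      then show ?thesis by (auto simp: W_def acceptance_game_def)
    qed
  qed
  then show "accepted Sig0 \<A> T"
    unfolding accepted_def using V(1)
    by (intro verifier_closed_imp_winning[where W = W]) (auto simp: W_def acceptance_game_def)
qed

text \<open>In contrast to \<open>acc_closed\<close>, the distance is chosen per position. The
  canonical candidate, the infimum of the budgets that \<open>V\<close> contains at
  \<open>(b, v)\<close>, need not be attained, and then Falsifier could reply with a position
  outside \<open>V\<close>.\<close>

definition eps_closed ::
    "'l set \<Rightarrow> (real \<Rightarrow> real \<Rightarrow> real) \<Rightarrow> ('q, 'l) automaton \<Rightarrow> 'l ltree \<Rightarrow>
     ('q \<times> word \<times> real) set \<Rightarrow> bool" where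
  "eps_closed Sig0 f \<A> T V \<longleftrightarrow>
     V \<subseteq> states \<A> \<times> nodes T \<times> {0..1} \<and>
     (\<forall>(a, w, e)\<in>V. \<exists>\<delta>\<in>trans \<A> a. \<exists>d\<in>dist_funs (states \<A>) (nodes T).
        dist_lift f d \<delta> (succ Sig0 T w) \<le> e \<and>
        (\<forall>b\<in>states \<A>. \<forall>v\<in>nodes T. \<forall>e'\<in>{0..1}. d (b, v) \<le> e' \<longrightarrow> (b, v, e') \<in> V))"

lemma eps_accepted_iff:
  assumes "init \<A> \<in> states \<A>" "root \<in> nodes T" "e \<in> {0..1}"
  shows "eps_accepted Sig0 f e \<A> T \<longleftrightarrow>
    (\<exists>V. (init \<A>, root, e) \<in> V \<and> eps_closed Sig0 f \<A> T V)"
proof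
  let ?G = "eps_acceptance_game Sig0 f \<A> T"
  assume "eps_accepted Sig0 f e \<A> T"
  then obtain W where W: "EState (init \<A>) root e \<in> W" "verifier_closed ?G W"
    unfolding eps_accepted_def by (blast dest: winning_imp_verifier_closed)
  define V where
    "V = {(a, w, e). a \<in> states \<A> \<and> w \<in> nodes T \<and> e \<in> {0..1} \<and> EState a w e \<in> W}"
  have "\<exists>\<delta>\<in>trans \<A> a. \<exists>d\<in>dist_funs (states \<A>) (nodes T).
        dist_lift f d \<delta> (succ Sig0 T w) \<le> e \<and>
        (\<forall>b\<in>states \<A>. \<forall>v\<in>nodes T. \<forall>e'\<in>{0..1}. d (b, v) \<le> e' \<longrightarrow> (b, v, e') \<in> V)"
    if "(a, w, e) \<in> V" for a w e
  proof -
    have "EState a w e \<in> W" using that by (simp add: V_def)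
    then have "eps_moves Sig0 f \<A> T (EState a w e) \<inter> W \<noteq> {}"
      using verifier_closed_Verifier[OF W(2), of "EState a w e"] by (simp add: eps_acceptance_game_def)
    then obtain \<delta> where \<delta>: "\<delta> \<in> trans \<A> a" "EChosen \<delta> w e \<in> W" by auto
    then have "eps_moves Sig0 f \<A> T (EChosen \<delta> w e) \<inter> W \<noteq> {}"
      using verifier_closed_Verifier[OF W(2), of "EChosen \<delta> w e"] by (simp add: eps_acceptance_game_def)
    then obtain d where d: "d \<in> dist_funs (states \<A>) (nodes T)"
        "dist_lift f d \<delta> (succ Sig0 T w) \<le> e" "EDist d \<in> W"
      by auto
    then have "eps_moves Sig0 f \<A> T (EDist d) \<subseteq> W"
      using verifier_closed_Falsifier[OF W(2), of "EDist d"] by (simp add: eps_acceptance_game_def)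
    then have "\<forall>b\<in>states \<A>. \<forall>v\<in>nodes T. \<forall>e'\<in>{0..1}. d (b, v) \<le> e' \<longrightarrow> (b, v, e') \<in> V"
      unfolding V_def by auto
    then show ?thesis using \<delta> d by blast
  qed
  then have "eps_closed Sig0 f \<A> T V" unfolding eps_closed_def by (auto simp: V_def)
  moreover have "(init \<A>, root, e) \<in> V" using W assms by (simp add: V_def)
  ultimately show "\<exists>V. (init \<A>, root, e) \<in> V \<and> eps_closed Sig0 f \<A> T V" by blast
next
  let ?G = "eps_acceptance_game Sig0 f \<A> T"
  assume "\<exists>V. (init \<A>, root, e) \<in> V \<and> eps_closed Sig0 f \<A> T V"
  then obtain V where V: "(init \<A>, root, e) \<in> V" "eps_closed Sig0 f \<A> T V" by blast
  \<comment> \<open>The distances against which every reply of Falsifier lands in \<open>V\<close>.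
    All of them enter \<open>W\<close>, as there need not be a single best one.\<close>
  define D where "D = {d \<in> dist_funs (states \<A>) (nodes T).
    \<forall>b\<in>states \<A>. \<forall>v\<in>nodes T. \<forall>e'\<in>{0..1}. d (b, v) \<le> e' \<longrightarrow> (b, v, e') \<in> V}"
  define W where "W = {EState a w e | a w e. (a, w, e) \<in> V}
    \<union> {EChosen \<delta> w e | \<delta> w e. \<exists>d\<in>D. dist_lift f d \<delta> (succ Sig0 T w) \<le> e} \<union> EDist ` D"
  have step: "\<exists>\<delta>\<in>trans \<A> a. \<exists>d\<in>D. dist_lift f d \<delta> (succ Sig0 T w) \<le> e"
    if "(a, w, e) \<in> V" for a w e
    using V(2) that unfolding eps_closed_def D_def by fast
  have "verifier_closed ?G W"
    unfolding verifier_closed_def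
  proof
    fix q assume "q \<in> W"
    then consider (S) a w e where "q = EState a w e" "(a, w, e) \<in> V"
      | (C) \<delta> w e d where "q = EChosen \<delta> w e" "d \<in> D" "dist_lift f d \<delta> (succ Sig0 T w) \<le> e"
      | (D) d where "q = EDist d" "d \<in> D"
      unfolding W_def by blast
    then show "(owner ?G q = Verifier \<longrightarrow> moves ?G q \<inter> W \<noteq> {}) \<and>
       (owner ?G q = Falsifier \<longrightarrow> moves ?G q \<subseteq> W)"
    proof cases
      case S
      with step obtain \<delta> where "\<delta> \<in> trans \<A> a" "\<exists>d\<in>D. dist_lift f d \<delta> (succ Sig0 T w) \<le> e"
        by blast
      then have "EChosen \<delta> w e \<in> moves ?G q \<inter> W"
        using S by (auto simp: W_def eps_acceptance_game_def)
      then show ?thesis using S by (auto simp: eps_acceptance_game_def)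
    next
      case C
      then have "EDist d \<in> moves ?G q \<inter> W"
        by (auto simp: W_def eps_acceptance_game_def D_def)
      then show ?thesis using C by (auto simp: eps_acceptance_game_def)
    next
      case D
      then show ?thesis by (auto simp: W_def eps_acceptance_game_def D_def)
    qed
  qed
  then show "eps_accepted Sig0 f e \<A> T"
    unfolding eps_accepted_def using V(1)
    by (intro verifier_closed_imp_winning[where W = W]) (auto simp: W_def eps_acceptance_game_def)
qed

section \<open>The least bisimulation distance\<close>

lemma least_bisim_dist_fun_d_star:
  assumes "order_preserving f" "labelled_tree Sig0 Sig2 T'" "labelled_tree Sig0 Sig2 T"
  shows "least_bisim_dist_fun Sig0 f T' T (d_star Sig0 f T' T)"
  unfolding d_star_def using ex1_least_bisim_dist_fun[OF assms] by (rule theI')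

lemma bd_le:
  assumes "order_preserving f" "labelled_tree Sig0 Sig2 T'" "labelled_tree Sig0 Sig2 T"
    and "bisim_dist_fun Sig0 f T' T d"
  shows "bd Sig0 f T' T \<le> d (root, root)"
  using least_bisim_dist_fun_d_star[OF assms(1-3)] assms(2-4)
  unfolding bd_def least_bisim_dist_fun_def labelled_tree_def by blast

section \<open>From a nearby accepted tree to \<epsilon>-acceptance\<close>

text \<open>The invariant \<open>E\<close>: a budget below 1 at \<open>(a, w)\<close> is backed by a
  node \<open>w'\<close> of \<open>T'\<close> with \<open>(a, w')\<close> in the region
  \<open>V\<close> and \<open>ds (w', w)\<close> within the budget. Because \<open>ds\<close>
  dominates its own lifting, the transition used at \<open>w'\<close> hands this invariant on to the
  successors.\<close>

lemma accepted_imp_eps_accepted: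
  fixes \<A> :: "('q, 'l) automaton"
  assumes f: "order_preserving f" and A: "tree_automaton Sig0 Sig2 \<A>" and df: "deadlock_free \<A>"
    and T: "labelled_tree Sig0 Sig2 T" and e0: "\<epsilon>0 \<in> {0..1}"
    and T': "labelled_tree Sig0 Sig2 T'" and bd: "bd Sig0 f T' T \<le> \<epsilon>0" and acc: "accepted Sig0 \<A> T'"
  shows "eps_accepted Sig0 f \<epsilon>0 \<A> T"
proof -
  let ?D = "dist_funs (states \<A>) (nodes T)"
  have roots: "root \<in> nodes T" "root \<in> nodes T'"
    using T T' by (auto simp: labelled_tree_def)
  have init: "init \<A> \<in> states \<A>"
    and trans: "\<And>a \<delta>. a \<in> states \<A> \<Longrightarrow> \<delta> \<in> trans \<A> a \<Longrightarrow> \<delta> \<in> F_set Sig0 Sig2 (states \<A>)"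
    using A unfolding tree_automaton_def by blast+
  define ds where "ds = d_star Sig0 f T' T"
  have ds: "ds \<in> dist_funs (nodes T') (nodes T)"
    and ds_ge: "\<And>w' w. w' \<in> nodes T' \<Longrightarrow> w \<in> nodes T \<Longrightarrow>
        dist_lift f ds (succ Sig0 T' w') (succ Sig0 T w) \<le> ds (w', w)"
    using least_bisim_dist_fun_d_star[OF f T' T]
    unfolding ds_def least_bisim_dist_fun_def bisim_dist_fun_def by blast+
  have ds01: "ds (w', w) \<in> {0..1}" if "w' \<in> nodes T'" "w \<in> nodes T" for w' w
    using ds that unfolding dist_funs_def by (blast intro: PiE_mem)
  obtain V where V0: "(init \<A>, root) \<in> V" and V: "acc_closed Sig0 \<A> T' V"
    using acc accepted_iff[OF init roots(2)] by blast
  have V_sub: "V \<subseteq> states \<A> \<times> nodes T'" using V by (simp add: acc_closed_def)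
  define E where "E = {(a, w, e). a \<in> states \<A> \<and> w \<in> nodes T \<and> e \<in> {0..1} \<and>
    (e = 1 \<or> (\<exists>w'. (a, w') \<in> V \<and> ds (w', w) \<le> e))}"
  \<comment> \<open>Against the constant 1 Falsifier can only reply with budget 1, and such
    positions belong to \<open>E\<close> outright.\<close>
  define one where "one = (\<lambda>p\<in>states \<A> \<times> nodes T. 1::real)"
  have one: "one \<in> ?D" by (auto simp: one_def dist_funs_def)
  have one_E: "(b, v, e') \<in> E" if "b \<in> states \<A>" "v \<in> nodes T" "e' \<in> {0..1}" "one (b, v) \<le> e'" for b v e'
    using that by (auto simp: one_def E_def)
  have "\<exists>\<delta>\<in>trans \<A> a. \<exists>d\<in>?D. dist_lift f d \<delta> (succ Sig0 T w) \<le> e \<and>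
        (\<forall>b\<in>states \<A>. \<forall>v\<in>nodes T. \<forall>e'\<in>{0..1}. d (b, v) \<le> e' \<longrightarrow> (b, v, e') \<in> E)"
    if awe: "(a, w, e) \<in> E" for a w e
  proof -
    have a: "a \<in> states \<A>" and w: "w \<in> nodes T" and e: "e \<in> {0..1}" using awe by (auto simp: E_def)
    note sw = succ_in_F_set[OF T w]
    show ?thesis
    proof (cases "e = 1")
      case True
      obtain \<delta> where \<delta>: "\<delta> \<in> trans \<A> a" using df a unfolding deadlock_free_def by blast
      \<comment> \<open>Lifted distances never exceed 1, so any transition is affordable
        here.\<close>
      have "dist_lift f one \<delta> (succ Sig0 T w) \<le> e"
        using dist_lift_in_01[OF f one trans[OF a \<delta>] sw] True by simp
      then show ?thesis using \<delta> one one_E by blast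
    next
      case False
      then obtain w' where aw': "(a, w') \<in> V" and le: "ds (w', w) \<le> e"
        using awe by (auto simp: E_def)
      have w': "w' \<in> nodes T'" using aw' V_sub by blast
      obtain \<delta> where \<delta>: "\<delta> \<in> trans \<A> a" and rel: "rel_lift V \<delta> (succ Sig0 T' w')"
        using V aw' unfolding acc_closed_def by blast
      \<comment> \<open>A lifted distance below 1 excludes the clauses of \<open>dist_lift\<close>
        with constant value 1, so \<open>w'\<close> and \<open>w\<close> have the same label and the
        same arity.\<close>
      have lift: "dist_lift f ds (succ Sig0 T' w') (succ Sig0 T w) < 1"
          "dist_lift f ds (succ Sig0 T' w') (succ Sig0 T w) \<le> e"
        using ds_ge[OF w' w] le e False by auto
      show ?thesis
      proof (cases \<delta>)
        case (Inl c)
        then have "succ Sig0 T' w' = Inl c"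
          using rel by (cases "succ Sig0 T' w'") auto
        \<comment> \<open>Equal leaves have lifted distance 0 under any distance, so the harmless
          \<open>one\<close> can be offered.\<close>
        then have "dist_lift f one \<delta> (succ Sig0 T w) \<le> e"
          using lift Inl by (cases "succ Sig0 T w") auto
        then show ?thesis using \<delta> one one_E by blast
      next
        case (Inr t)
        then obtain s b0 b1 where t: "\<delta> = Inr (s, b0, b1)" by (cases t) auto
        then have s': "succ Sig0 T' w' = Inr (s, child0 w', child1 w')"
            and b0: "(b0, child0 w') \<in> V" and b1: "(b1, child1 w') \<in> V"
          using rel by (auto simp: succ_def split: if_splits)
        then have s: "succ Sig0 T w = Inr (s, child0 w, child1 w)"
          using lift(1) by (auto simp: succ_def split: if_splits)
        have ch: "child0 w \<in> nodes T" "child1 w \<in> nodes T"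
          using sw unfolding s F_set_def by auto
        have V_nodes: "child0 w' \<in> nodes T'" "child1 w' \<in> nodes T'" "b0 \<in> states \<A>" "b1 \<in> states \<A>"
          using b0 b1 V_sub by auto
        \<comment> \<open>The \<open>min\<close> covers \<open>b0 = b1\<close>, where one value must
          serve both children. Each value is either 1 or realised by one of the two successors of
          \<open>w'\<close>, so a reply of Falsifier always finds its backing node.\<close>
        define d where "d = (\<lambda>(b, v)\<in>states \<A> \<times> nodes T.
          min (if b = b0 then ds (child0 w', v) else 1) (if b = b1 then ds (child1 w', v) else 1))"
        have d: "d \<in> ?D"
          using ds01[OF V_nodes(1)] ds01[OF V_nodes(2)] unfolding dist_funs_def d_def
          by (intro restrict_PiE_iff[THEN iffD2]) (auto simp: min_def)
        have d01: "d (b, v) \<in> {0..1}" if "b \<in> states \<A>" "v \<in> nodes T" for b v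
          using d that unfolding dist_funs_def by (blast intro: PiE_mem)
        have le0: "d (b0, child0 w) \<le> ds (child0 w', child0 w)"
          and le1: "d (b1, child1 w) \<le> ds (child1 w', child1 w)"
          using ch V_nodes by (auto simp: d_def)
        \<comment> \<open>\<open>d\<close> and \<open>ds\<close> live on different carriers, so
          \<open>dist_lift_mono\<close> does not apply and \<open>f\<close> is compared one argument
          at a time.\<close>
        have "f (d (b0, child0 w)) (d (b1, child1 w)) \<le> f (ds (child0 w', child0 w)) (d (b1, child1 w))"
          using f le0 d01 ds01 ch V_nodes unfolding order_preserving_def
          by (auto intro: mono_onD[where A = "{0..1}" and f = "\<lambda>x. f x (d (b1, child1 w))"])
        also have "\<dots> \<le> f (ds (child0 w', child0 w)) (ds (child1 w', child1 w))"
          using f le1 d01 ds01 ch V_nodes unfolding order_preserving_def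
          by (auto intro: mono_onD[where A = "{0..1}" and f = "\<lambda>y. f (ds (child0 w', child0 w)) y"])
        also have "\<dots> \<le> e" using lift(2) s s' by simp
        finally have "dist_lift f d \<delta> (succ Sig0 T w) \<le> e" using s t by simp
        moreover have "(b, v, e') \<in> E"
          if "b \<in> states \<A>" "v \<in> nodes T" "e' \<in> {0..1}" "d (b, v) \<le> e'" for b v e'
        proof -
          have "(b = b0 \<and> ds (child0 w', v) \<le> e') \<or> (b = b1 \<and> ds (child1 w', v) \<le> e') \<or> e' = 1"
            using that by (auto simp: d_def min_def split: if_splits)
          then show ?thesis using that b0 b1 unfolding E_def by blast
        qed
        ultimately show ?thesis using \<delta> d by blast
      qed
    qed
  qed
  then have "eps_closed Sig0 f \<A> T E"
    unfolding eps_closed_def by (auto simp: E_def)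
  moreover have "(init \<A>, root, \<epsilon>0) \<in> E"
    using init roots e0 V0 bd unfolding E_def bd_def ds_def by auto
  ultimately show ?thesis
    using eps_accepted_iff[OF init roots(1) e0] by blast
qed

section \<open>Unravelling an \<epsilon>-acceptance region into an accepted tree\<close>

text \<open>The nodes of \<open>T\<close> play no role once the budget is 1, so the word component of a
  position need not be a node of \<open>T\<close>.\<close>

definition run_step ::
    "'l set \<Rightarrow> (real \<Rightarrow> real \<Rightarrow> real) \<Rightarrow> 'l ltree \<Rightarrow> ('q \<times> word \<times> real) set \<Rightarrow>
     word \<Rightarrow> real \<Rightarrow> ('l, 'q) F \<Rightarrow> real \<Rightarrow> real \<Rightarrow> bool" where
  "run_step Sig0 f T W w e \<delta> e0 e1 \<longleftrightarrow>
     (case \<delta> of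
        Inl c \<Rightarrow> e = 1 \<or> succ Sig0 T w = Inl c
      | Inr (s, b0, b1) \<Rightarrow> (b0, child0 w, e0) \<in> W \<and> (b1, child1 w, e1) \<in> W \<and>
          (e = 1 \<or> succ Sig0 T w = Inr (s, child0 w, child1 w) \<and> f e0 e1 \<le> e))"

text \<open>\<open>W\<close> adds to \<open>V\<close> all states at all words with budget 1, a part
  closed under arbitrary transitions. Below budget 1 the transition comes from \<open>V\<close>, and
  the child budgets are the values of its distance at the two successors, the smallest budgets
  Falsifier may choose there.\<close>

lemma eps_closed_imp_run_step:
  assumes f: "order_preserving f" and A: "tree_automaton Sig0 Sig2 \<A>" and df: "deadlock_free \<A>"
    and T: "labelled_tree Sig0 Sig2 T" and V: "eps_closed Sig0 f \<A> T V"
    and W: "W = V \<union> states \<A> \<times> UNIV \<times> {1}" and awe: "(a, w, e) \<in> W"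
  shows "\<exists>\<delta>\<in>trans \<A> a. \<exists>e0 e1. run_step Sig0 f T W w e \<delta> e0 e1"
proof -
  have V_sub: "V \<subseteq> states \<A> \<times> nodes T \<times> {0..1}" using V by (simp add: eps_closed_def)
  have a: "a \<in> states \<A>" using awe W V_sub by auto
  have trans: "\<delta> \<in> F_set Sig0 Sig2 (states \<A>)" if "\<delta> \<in> trans \<A> a" for \<delta>
    using A a that unfolding tree_automaton_def by blast
  show ?thesis
  proof (cases "e = 1")
    case True
    obtain \<delta> where \<delta>: "\<delta> \<in> trans \<A> a" using df a unfolding deadlock_free_def by blast
    \<comment> \<open>Child budgets 1 land in the added part of \<open>W\<close>, even if the child
      words are not nodes of \<open>T\<close>.\<close>
    have "run_step Sig0 f T W w e \<delta> 1 1"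
      using trans[OF \<delta>] True unfolding run_step_def W F_set_def by auto
    then show ?thesis using \<delta> by blast
  next
    case False
    then have awe: "(a, w, e) \<in> V" using awe W by auto
    then have e: "e < 1" and w: "w \<in> nodes T" using False V_sub by auto
    obtain \<delta> d where \<delta>: "\<delta> \<in> trans \<A> a" and d: "d \<in> dist_funs (states \<A>) (nodes T)"
      and le: "dist_lift f d \<delta> (succ Sig0 T w) \<le> e"
      and next_V: "\<And>b v e'. b \<in> states \<A> \<Longrightarrow> v \<in> nodes T \<Longrightarrow> e' \<in> {0..1} \<Longrightarrow> d (b, v) \<le> e' \<Longrightarrow> (b, v, e') \<in> V"
      using V awe unfolding eps_closed_def by blast
    have next_V': "(b, v, d (b, v)) \<in> V" if "b \<in> states \<A>" "v \<in> nodes T" for b v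
    proof -
      have "d (b, v) \<in> {0..1}" using d that unfolding dist_funs_def by (blast intro: PiE_mem)
      then show ?thesis using next_V that by blast
    qed
    show ?thesis
    proof (cases \<delta>)
      case (Inl c)
      \<comment> \<open>A leaf has no children, so both budgets are placeholders;
        \<open>e < 1\<close> forces the same leaf in \<open>T\<close>.\<close>
      then have "run_step Sig0 f T W w e \<delta> 1 1"
        using le e by (cases "succ Sig0 T w") (auto simp: run_step_def split: if_splits)
      then show ?thesis using \<delta> by blast
    next
      case (Inr t)
      then obtain s b0 b1 where t: "\<delta> = Inr (s, b0, b1)" by (cases t) auto
      then have s: "succ Sig0 T w = Inr (s, child0 w, child1 w)"
        using le e by (auto simp: succ_def split: if_splits)
      have "child0 w \<in> nodes T" "child1 w \<in> nodes T" "b0 \<in> states \<A>" "b1 \<in> states \<A>"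
        using succ_in_F_set[OF T w] trans[OF \<delta>] unfolding s t F_set_def by auto
      then have "run_step Sig0 f T W w e \<delta> (d (b0, child0 w)) (d (b1, child1 w))"
        using le next_V' unfolding run_step_def W s t by auto
      then show ?thesis using \<delta> by blast
    qed
  qed
qed

text \<open>\<open>T'\<close> is read off the transitions followed from the root, and may grow
  beyond \<open>T\<close> where the budget is 1. Below budget 1 it agrees with \<open>T\<close>
  locally, so the budgets bound the distance of corresponding nodes, and the states passed through
  witness acceptance.\<close>

lemma eps_accepted_imp_accepted:
  fixes \<A> :: "('q, 'l) automaton" and T :: "'l ltree"
  assumes disj: "Sig0 \<inter> Sig2 = {}" and f: "order_preserving f"
    and A: "tree_automaton Sig0 Sig2 \<A>" and df: "deadlock_free \<A>"
    and T: "labelled_tree Sig0 Sig2 T" and e0: "\<epsilon>0 \<in> {0..1}"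
    and acc: "eps_accepted Sig0 f \<epsilon>0 \<A> T"
  shows "\<exists>T' :: 'l ltree. labelled_tree Sig0 Sig2 T' \<and> bd Sig0 f T' T \<le> \<epsilon>0 \<and> accepted Sig0 \<A> T'"
proof -
  have root: "root \<in> nodes T" using T by (auto simp: labelled_tree_def)
  have init: "init \<A> \<in> states \<A>"
    and trans: "\<And>a \<delta>. a \<in> states \<A> \<Longrightarrow> \<delta> \<in> trans \<A> a \<Longrightarrow> \<delta> \<in> F_set Sig0 Sig2 (states \<A>)"
    using A unfolding tree_automaton_def by blast+
  obtain V where V0: "(init \<A>, root, \<epsilon>0) \<in> V" and V: "eps_closed Sig0 f \<A> T V"
    using acc eps_accepted_iff[OF init root e0] by blast
  define W where "W = V \<union> states \<A> \<times> UNIV \<times> {1}"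
  have W_sub: "a \<in> states \<A>" "e \<in> {0..1}" if "(a, w, e) \<in> W" for a w e
    using that V unfolding W_def eps_closed_def by auto
  have "\<forall>x\<in>W. \<exists>\<delta> e0 e1. \<delta> \<in> trans \<A> (fst x) \<and>
      run_step Sig0 f T W (fst (snd x)) (snd (snd x)) \<delta> e0 e1"
    using eps_closed_imp_run_step[OF f A df T V W_def] by force
  \<comment> \<open>One choice per position makes the run deterministic: every word determines a
    single state and budget.\<close>
  then obtain \<delta> \<eta>0 \<eta>1 where choice: "\<And>x. x \<in> W \<Longrightarrow> \<delta> x \<in> trans \<A> (fst x) \<and>
      run_step Sig0 f T W (fst (snd x)) (snd (snd x)) (\<delta> x) (\<eta>0 x) (\<eta>1 x)"
    unfolding bchoice_iff by metis
  \<comment> \<open>The leaf clause returns a placeholder, as words below a leaf are not nodes of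
    \<open>T'\<close>.\<close>
  define stp where "stp x b = (case x of (a, w, e) \<Rightarrow> (case \<delta> x of
      Inl c \<Rightarrow> x
    | Inr (s, b0, b1) \<Rightarrow> if b then (b1, child1 w, \<eta>1 x) else (b0, child0 w, \<eta>0 x)))" for x b
  define run where "run = foldl stp (init \<A>, root, \<epsilon>0)"
  \<comment> \<open>In \<open>w = u @ b # v\<close> the word \<open>u\<close> ranges over the proper
    prefixes of \<open>w\<close>, so a word is a node iff no leaf transition occurs strictly above
    it.\<close>
  define T' where "T' = \<lparr>nodes = {w. \<forall>u b v. w = u @ b # v \<longrightarrow> \<not> isl (\<delta> (run u))},
    label = (\<lambda>w. case \<delta> (run w) of Inl c \<Rightarrow> c | Inr (s, b0, b1) \<Rightarrow> s)\<rparr>"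
  have run_root: "run root = (init \<A>, root, \<epsilon>0)" by (simp add: run_def)
  have run_snoc: "run (w @ [b]) = stp (run w) b" for w b by (simp add: run_def)
  have node_root: "root \<in> nodes T'" by (simp add: T'_def)
  have node_snoc: "w @ [b] \<in> nodes T' \<longleftrightarrow> w \<in> nodes T' \<and> \<not> isl (\<delta> (run w))" for w b
  proof
    assume "w @ [b] \<in> nodes T'"
    then show "w \<in> nodes T' \<and> \<not> isl (\<delta> (run w))"
      unfolding T'_def by fastforce
  next
    assume *: "w \<in> nodes T' \<and> \<not> isl (\<delta> (run w))"
    \<comment> \<open>Either \<open>v\<close> is empty and \<open>u\<close> is \<open>w\<close>
      itself, or \<open>u\<close> is already a proper prefix of \<open>w\<close>.\<close>
    have "\<not> isl (\<delta> (run u))" if "w @ [b] = u @ c # v" for u c v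
      using that * by (cases v rule: rev_cases) (auto simp: T'_def)
    then show "w @ [b] \<in> nodes T'" by (auto simp: T'_def)
  qed
  have run_W: "\<exists>a e. run w = (a, w, e) \<and> (a, w, e) \<in> W" if "w \<in> nodes T'" for w
    using that
  proof (induction w rule: rev_induct)
    case Nil
    then show ?case using V0 by (simp add: run_root W_def)
  next
    case (snoc b w)
    then obtain a e where r: "run w = (a, w, e)" "(a, w, e) \<in> W" using node_snoc by blast
    obtain s b0 b1 where t: "\<delta> (run w) = Inr (s, b0, b1)"
      using snoc.prems node_snoc[of w b] by (cases "\<delta> (run w)") auto
    show ?case using choice[OF r(2)] r t by (auto simp: run_snoc stp_def run_step_def)
  qed
  \<comment> \<open>\<open>st\<close> is the state the automaton assigns to a node of
    \<open>T'\<close>, \<open>bg\<close> the budget left there.\<close>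
  obtain st bg where st_bg: "\<And>w. w \<in> nodes T' \<Longrightarrow> run w = (st w, w, bg w) \<and> (st w, w, bg w) \<in> W"
    using run_W by metis
  \<comment> \<open>One case distinction serves the tree axioms of \<open>T'\<close>, the
    bisimulation distance and acceptance.\<close>
  have node_cases: "(\<exists>c. c \<in> Sig0 \<and> \<delta> (run w) = Inl c \<and> succ Sig0 T' w = Inl c \<and>
        (bg w = 1 \<or> succ Sig0 T w = Inl c)) \<or>
      (\<exists>s. s \<in> Sig2 \<and> child0 w \<in> nodes T' \<and> child1 w \<in> nodes T' \<and>
        \<delta> (run w) = Inr (s, st (child0 w), st (child1 w)) \<and>
        succ Sig0 T' w = Inr (s, child0 w, child1 w) \<and>
        (bg w = 1 \<or> succ Sig0 T w = Inr (s, child0 w, child1 w) \<and> f (bg (child0 w)) (bg (child1 w)) \<le> bg w))"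
    if w: "w \<in> nodes T'" for w
  proof -
    have r: "run w = (st w, w, bg w)" and rW: "(st w, w, bg w) \<in> W" using st_bg[OF w] by auto
    note ch = choice[OF rW]
    have F: "\<delta> (run w) \<in> F_set Sig0 Sig2 (states \<A>)"
      using trans[of "st w"] W_sub(1)[OF rW] ch r by simp
    show ?thesis
    proof (cases "\<delta> (run w)")
      case (Inl c)
      then have "c \<in> Sig0" using F unfolding F_set_def by auto
      then show ?thesis using Inl ch r by (auto simp: succ_def T'_def run_step_def)
    next
      case (Inr t)
      then obtain s b0 b1 where t: "\<delta> (run w) = Inr (s, b0, b1)" by (cases t) auto
      \<comment> \<open>\<open>succ\<close> tests membership in \<open>Sig0\<close> first, so
        disjointness of the label sets makes this an inner node.\<close>
      then have s: "s \<in> Sig2" "s \<notin> Sig0" using F disj unfolding F_set_def by auto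
      have ns: "child0 w \<in> nodes T'" "child1 w \<in> nodes T'" using node_snoc w t by auto
      have "run (child0 w) = (b0, child0 w, \<eta>0 (run w))" "run (child1 w) = (b1, child1 w, \<eta>1 (run w))"
        using t r by (auto simp: run_snoc stp_def)
      then have "st (child0 w) = b0" "bg (child0 w) = \<eta>0 (run w)"
          "st (child1 w) = b1" "bg (child1 w) = \<eta>1 (run w)"
        using st_bg[OF ns(1)] st_bg[OF ns(2)] by auto
      then show ?thesis using s ns t ch r by (auto simp: succ_def T'_def run_step_def)
    qed
  qed
  have label_T': "label T' w = (case \<delta> (run w) of Inl c \<Rightarrow> c | Inr (s, b0, b1) \<Rightarrow> s)" for w
    by (simp add: T'_def)
  have T': "labelled_tree Sig0 Sig2 T'"
    unfolding labelled_tree_def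
  proof (intro conjI allI ballI impI node_root)
    show "u \<in> nodes T'" if "u @ v \<in> nodes T'" for u v
      using that by (induction v rule: rev_induct) (auto simp: node_snoc simp flip: append_assoc)
    show "child0 w \<in> nodes T' \<longleftrightarrow> child1 w \<in> nodes T'" for w by (simp add: node_snoc)
    show "label T' w \<in> Sig0 \<union> Sig2" if "w \<in> nodes T'" for w
      using node_cases[OF that] by (auto simp: label_T')
    show "label T' w \<in> Sig2 \<longleftrightarrow> child0 w \<in> nodes T' \<and> child1 w \<in> nodes T'" if "w \<in> nodes T'" for w
      using node_cases[OF that] disj by (auto simp: label_T' node_snoc)
  qed
  \<comment> \<open>The value 1 is always safe, since it bounds every lifted distance. On the
    diagonal the lifting pairs each child only with itself, so it again meets only diagonal
    values.\<close>
  define d where "d = (\<lambda>(w', w)\<in>nodes T' \<times> nodes T. if w' = w then bg w else 1)"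
  have d: "d \<in> dist_funs (nodes T') (nodes T)"
    unfolding dist_funs_def d_def
    by (intro restrict_PiE_iff[THEN iffD2]) (use st_bg W_sub(2) in auto)
  have "dist_lift f d (succ Sig0 T' w') (succ Sig0 T w) \<le> d (w', w)"
    if w': "w' \<in> nodes T'" and w: "w \<in> nodes T" for w' w
  proof (cases "w' = w \<and> bg w \<noteq> 1")
    case False
    then have "d (w', w) = 1" using w w' by (auto simp: d_def)
    then show ?thesis
      using dist_lift_in_01[OF f d succ_in_F_set[OF T' w'] succ_in_F_set[OF T w]] by simp
  next
    case True
    then have eq: "w' = w" and bg: "bg w \<noteq> 1" by auto
    have dw: "d (w', w) = bg w" "bg w \<ge> 0"
      using eq w w' st_bg[OF w'] W_sub(2)[of "st w" w "bg w"] by (auto simp: d_def)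
    consider (leaf) c where "succ Sig0 T' w = Inl c" "succ Sig0 T w = Inl c"
      | (inner) s where "child0 w \<in> nodes T'" "child1 w \<in> nodes T'"
        "succ Sig0 T' w = Inr (s, child0 w, child1 w)" "succ Sig0 T w = Inr (s, child0 w, child1 w)"
        "f (bg (child0 w)) (bg (child1 w)) \<le> bg w"
      using node_cases[OF w'] bg eq by blast
    then show ?thesis
    proof cases
      case leaf
      then show ?thesis using dw eq by simp
    next
      case inner
      \<comment> \<open>\<open>d\<close> takes the values of \<open>bg\<close> only inside its
        carriers, so the children must be nodes of \<open>T\<close> as well as of
        \<open>T'\<close>.\<close>
      have "child0 w \<in> nodes T" "child1 w \<in> nodes T"
        using succ_in_F_set[OF T w] inner(4) unfolding F_set_def by auto
      then show ?thesis using inner dw eq by (simp add: d_def)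
    qed
  qed
  then have "bisim_dist_fun Sig0 f T' T d" using d unfolding bisim_dist_fun_def by blast
  then have "bd Sig0 f T' T \<le> d (root, root)" by (rule bd_le[OF f T' T])
  also have "\<dots> = \<epsilon>0" using st_bg[OF node_root] node_root root by (simp add: d_def run_root)
  finally have "bd Sig0 f T' T \<le> \<epsilon>0" .
  moreover have "accepted Sig0 \<A> T'"
  proof -
    \<comment> \<open>The graph of the run: each node is paired with its one state, and the chosen
      transition leads exactly to the pairs of its children.\<close>
    define X where "X = (\<lambda>w. (st w, w)) ` nodes T'"
    have "\<exists>\<delta>'\<in>trans \<A> (st w). rel_lift X \<delta>' (succ Sig0 T' w)" if w: "w \<in> nodes T'" for w
    proof
      show "\<delta> (run w) \<in> trans \<A> (st w)"
        using choice[of "run w"] st_bg[OF w] by simp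
      show "rel_lift X (\<delta> (run w)) (succ Sig0 T' w)"
        using node_cases[OF w] by (auto simp: X_def)
    qed
    then have "acc_closed Sig0 \<A> T' X"
      using st_bg W_sub(1) unfolding acc_closed_def X_def by blast
    moreover have "(init \<A>, root) \<in> X"
      using st_bg[OF node_root] node_root by (force simp: X_def run_root)
    ultimately show ?thesis using accepted_iff[OF init node_root] by blast
  qed
  ultimately show ?thesis using T' by blast
qed

theorem theorem4p1:
  fixes Sig0 Sig2 :: "'l set"
    and f :: "real \<Rightarrow> real \<Rightarrow> real"
    and \<A> :: "('q, 'l) automaton"
    and T :: "'l ltree"
    and \<epsilon>0 :: real
  assumes "Sig0 \<inter> Sig2 = {}"
    and "order_preserving f"
    and "tree_automaton Sig0 Sig2 \<A>"
    and "deadlock_free \<A>"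
    and "labelled_tree Sig0 Sig2 T"
    and "\<epsilon>0 \<in> {0..1}"
  shows "eps_accepted Sig0 f \<epsilon>0 \<A> T \<longleftrightarrow>
    (\<exists>T' :: 'l ltree. labelled_tree Sig0 Sig2 T' \<and> bd Sig0 f T' T \<le> \<epsilon>0 \<and> accepted Sig0 \<A> T')"
  using eps_accepted_imp_accepted[OF assms] accepted_imp_eps_accepted[OF assms(2-6)] by blast

end
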